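(* The following four identities hold: $$\sum_{n=0}^{\infty}\frac{(-1)^{n+1}q^{\binom{n+2}{2}}}{(q;q^2)_{n+1}}=-q\sum_{n=0}^{\infty}(-1)^nq^{-n+5n(n+1)}-q^{2}\sum_{n=0}^{\infty}(-1)^nq^{n+5n(n+1)},$$ $$\sum_{n=0}^{\infty}\frac{(-1)^{n+1}q^{\binom{n+1}{2}}}{(q;q^2)_{n+1}}=-\sum_{n=0}^{\infty}(-1)^nq^{-3n+5n(n+1)}-q^{3}\sum_{n=0}^{\infty}(-1)^nq^{3n+5n(n+1)},$$ $$\sum_{n=0}^{\infty}\frac{(-1)^nq^{n(n+1)}}{(-q;q)_{2n}}=\sum_{n=0}^{\infty}q^{-2n+5n(n+1)/2}-q^2\sum_{n=0}^{\infty}q^{2n+5n(n+1)/2},$$ $$\sum_{n=0}^{\infty}\frac{(-1)^{n}q^{n(n+1)}}{(-q;q)_{2n+1}}=\sum_{n=0}^{\infty}q^{-n+5n(n+1)/2}-q\sum_{n=0}^{\infty}q^{n+5n(n+1)/2}.$$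
   Context: $q$ is a complex number with $0<|q|<1$, and $(x;q)_n=\prod_{i=0}^{n-1}(1-xq^i)$. *)

theory Defs
  imports "HOL-Analysis.Analysis"
begin

definition qpoch :: "complex \<Rightarrow> complex \<Rightarrow> nat \<Rightarrow> complex" where
  "qpoch x q n = (\<Prod>i<n. 1 - x * q ^ i)"

end

theory Submission
  imports Defs
begin

text \<open>
  Each left-hand side is \<open>\<Sum>n. (-1)\<^sup>n q\<^bsup>n(n+1)/2 + ln\<^esup> (q;q)\<^sub>n \<beta>\<^sub>n\<close> with \<open>l \<in> {0, 1}\<close>, up to a factor
  and with \<open>q\<close> replaced by \<open>q\<^sup>2\<close> in the last two identities. Here
  \<open>\<beta>\<^sub>n = \<Sum>r\<le>n. \<alpha>\<^sub>r / ((q;q)\<^bsub>n-r\<^esub> (q;q)\<^bsub>n+r+l+1\<^esub>)\<close> for an explicit \<open>\<alpha>\<close> of the form sign times power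
  of \<open>q\<close> times a binomial, i.e. a Bailey pair relative to \<open>q\<^bsup>l+1\<^esup>\<close>. The finite evaluations of \<open>\<beta>\<^sub>n\<close> follow
  by WZ telescoping in \<open>r\<close>. Exchanging the order of summation and evaluating the inner
  sum by the \<open>q\<close>-Chu--Vandermonde formula turns the left-hand side, truncated at \<open>N\<close>, into a sum
  over \<open>\<alpha>\<^sub>r\<close>; Tannery's theorem lets \<open>N\<close> tend to infinity.
\<close>

section \<open>The q-Chu--Vandermonde sum\<close>

lemma qpoch_0 [simp]: "qpoch x q 0 = 1"
  by (simp add: qpoch_def)

lemma qpoch_Suc: "qpoch x q (Suc n) = qpoch x q n * (1 - x * q ^ n)"
  by (simp add: qpoch_def)

lemma qfact_Suc: "qpoch q q (Suc n) = qpoch q q n * (1 - q ^ Suc n)"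
  by (simp add: qpoch_Suc)

lemma one_minus_mult_power_nonzero:
  fixes x q :: complex
  assumes "norm x < 1" "norm q < 1"
  shows "1 - x * q ^ i \<noteq> 0"
proof -
  have "norm (x * q ^ i) \<le> norm x"
    using assms by (simp add: norm_mult norm_power mult_left_le power_le_one)
  then have "norm (x * q ^ i) < 1" using assms by simp
  then show ?thesis by auto
qed

lemma one_minus_power_nonzero:
  fixes q :: complex
  assumes "norm q < 1" "i > 0"
  shows "1 - q ^ i \<noteq> 0"
  using one_minus_mult_power_nonzero[of q q "i - 1"] assms
  by (simp add: power_eq_if)

lemma qpoch_nonzero:
  assumes "norm x < 1" "norm q < 1"
  shows "qpoch x q n \<noteq> 0"
  using one_minus_mult_power_nonzero[OF assms] by (simp add: qpoch_def)

text \<open>The series of \<open>norm (x * q ^ i)\<close> is geometric, so the infinite product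
  converges absolutely; as no factor is zero, neither is the limit, which permits division by it
  later.\<close>

lemma qpoch_tendsto:
  assumes "norm x < 1" "norm q < 1"
  obtains L where "L \<noteq> 0" "qpoch x q \<longlonglongrightarrow> L"
proof -
  have "summable (\<lambda>i. norm (- x * q ^ i))"
    using assms by (simp add: norm_mult norm_power summable_mult summable_geometric)
  then have "abs_convergent_prod (\<lambda>i. 1 + (- x * q ^ i))"
    by (intro summable_imp_abs_convergent_prod) simp
  then have "convergent_prod (\<lambda>i. 1 - x * q ^ i)"
    using abs_convergent_prod_imp_convergent_prod by fastforce
  then obtain L where "L \<noteq> 0" "(\<lambda>n. \<Prod>i\<le>n. 1 - x * q ^ i) \<longlonglongrightarrow> L"
    using one_minus_mult_power_nonzero[OF assms] by (auto simp: convergent_prod_iff_nz_lim)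
  then have "(\<lambda>n. qpoch x q n) \<longlonglongrightarrow> L"
    unfolding qpoch_def using LIMSEQ_lessThan_iff_atMost by blast
  with \<open>L \<noteq> 0\<close> show thesis using that by blast
qed

lemma qpoch_Bseq:
  assumes "norm x < 1" "norm q < 1"
  shows "Bseq (qpoch x q)" "Bseq (\<lambda>n. 1 / qpoch x q n)"
proof -
  obtain L where L: "L \<noteq> 0" "qpoch x q \<longlonglongrightarrow> L"
    using qpoch_tendsto[OF assms] .
  then show "Bseq (qpoch x q)"
    using convergentI convergent_imp_Bseq by blast
  have "(\<lambda>n. 1 / qpoch x q n) \<longlonglongrightarrow> 1 / L"
    using L by (intro tendsto_intros)
  then show "Bseq (\<lambda>n. 1 / qpoch x q n)"
    using convergentI convergent_imp_Bseq by blast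
qed

text \<open>The Gaussian binomial coefficient, given by a q-Pascal rule instead of a quotient. Of
  the two Pascal rules this one suits the weights of the summation below: its factor
  \<open>q ^ (n - k)\<close> combines with them to a power free of the summation index.\<close>

fun qbinom :: "complex \<Rightarrow> nat \<Rightarrow> nat \<Rightarrow> complex" where
  "qbinom q n 0 = 1"
| "qbinom q 0 (Suc k) = 0"
| "qbinom q (Suc n) (Suc k) = qbinom q n (Suc k) + q ^ (n - k) * qbinom q n k"

lemma qbinom_eq_0: "n < k \<Longrightarrow> qbinom q n k = 0"
  by (induction q n k rule: qbinom.induct) auto

lemma qbinom_qfact: "k \<le> n \<Longrightarrow> qbinom q n k * (qpoch q q k * qpoch q q (n - k)) = qpoch q q n"
proof (induction q n k rule: qbinom.induct)
  case (3 q n k)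
  show ?case
  proof (cases "k = n")
    case True
    then show ?thesis using 3 by (auto simp: qbinom_eq_0 qpoch_Suc)
  next
    case False
    then obtain d where n: "n = Suc (k + d)"
      using 3 by (metis Suc_le_mono le_neq_implies_less less_iff_Suc_add)
    have 1: "qbinom q n (Suc k) * (qpoch q q (Suc k) * qpoch q q d) = qpoch q q n"
      and 2: "qbinom q n k * (qpoch q q k * qpoch q q (Suc d)) = qpoch q q n"
      using 3 by (auto simp: n)
    \<comment> \<open>After Pascal's rule both terms carry the factor \<open>qpoch q q n\<close>,
      and (1 - q^(d+1)) + q^(d+1) (1 - q^(k+1)) = 1 - q^(n+1) because n = k + d + 1.\<close>
    have "qbinom q (Suc n) (Suc k) * (qpoch q q (Suc k) * qpoch q q (Suc n - Suc k))
        = qbinom q n (Suc k) * (qpoch q q (Suc k) * qpoch q q d) * (1 - q ^ Suc d)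
          + q ^ Suc d * (1 - q ^ Suc k) * (qbinom q n k * (qpoch q q k * qpoch q q (Suc d)))"
      by (simp add: n qfact_Suc algebra_simps del: power_Suc)
    also have "\<dots> = qpoch q q n * (1 - q ^ Suc n)"
      unfolding 1 2 by (simp add: n algebra_simps power_add)
    finally show ?thesis by (simp add: qfact_Suc)
  qed
qed auto

text \<open>Pascal's rule applied under the sum; the overhanging term drops out because
  \<open>qbinom q M (Suc M)\<close> is zero.\<close>

lemma sum_qbinom_Suc:
  "(\<Sum>m\<le>Suc M. qbinom q (Suc M) m * f m)
   = (\<Sum>m\<le>M. qbinom q M m * f m) + (\<Sum>m\<le>M. q ^ (M - m) * qbinom q M m * f (Suc m))"
proof -
  have "(\<Sum>m\<le>Suc M. qbinom q (Suc M) m * f m)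
      = f 0 + (\<Sum>m\<le>M. qbinom q M (Suc m) * f (Suc m))
        + (\<Sum>m\<le>M. q ^ (M - m) * qbinom q M m * f (Suc m))"
    by (subst sum.atMost_Suc_shift) (simp add: sum.distrib algebra_simps)
  also have "f 0 + (\<Sum>m\<le>M. qbinom q M (Suc m) * f (Suc m)) = (\<Sum>m\<le>Suc M. qbinom q M m * f m)"
    by (subst sum.atMost_Suc_shift) simp
  also have "\<dots> = (\<Sum>m\<le>M. qbinom q M m * f m)"
    by (simp add: qbinom_eq_0)
  finally show ?thesis .
qed

lemma Suc_Suc_choose_two: "Suc (Suc n) choose 2 = (Suc n choose 2) + Suc n"
  by (simp add: numeral_2_eq_2)

text \<open>In standard form this is 2phi1(q^(-M), b; c; q, c q^M / b) = (c/b;q)_M / (c;q)_M with b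
  = q^(a+1) and c = q^(a+t+2), multiplied by (q;q)_a / (q;q)_(a+t+1). Pascal's rule splits the sum
  for M + 1 into sums for M at \<open>a\<close> and at \<open>Suc a\<close>, hence the induction
  with \<open>a\<close> arbitrary.\<close>

lemma q_Chu_Vandermonde:
  assumes "norm q < 1"
  shows "(\<Sum>m\<le>M. qbinom q M m *
            ((-1) ^ m * q ^ ((Suc m choose 2) + m * t) * (qpoch q q (m + a) / qpoch q q (m + a + Suc t))))
       = qpoch q q a * qpoch q q (M + t) / (qpoch q q t * qpoch q q (M + a + Suc t))"
proof (induction M arbitrary: a)
  case 0
  then show ?case using qpoch_nonzero[OF assms assms] by (simp add: numeral_2_eq_2)
next
  case (Suc M)
  let ?f = "\<lambda>a m. (-1) ^ m * q ^ ((Suc m choose 2) + m * t) * (qpoch q q (m + a) / qpoch q q (m + a + Suc t))"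
  \<comment> \<open>Shifting m by one raises the q-exponent by m + 1 + t, and the Pascal factor
    contributes M - m, so m cancels.\<close>
  have "q ^ (M - m) * qbinom q M m * ?f a (Suc m) = - (q ^ (M + Suc t)) * (qbinom q M m * ?f (Suc a) m)"
    if "m \<le> M" for m
  proof -
    have "q ^ (M - m) * q ^ ((Suc (Suc m) choose 2) + Suc m * t)
        = q ^ (M + Suc t) * q ^ ((Suc m choose 2) + m * t)"
      unfolding power_add[symmetric] using that by (simp add: Suc_Suc_choose_two ac_simps)
    then show ?thesis by (simp add: algebra_simps)
  qed
  then have "(\<Sum>m\<le>Suc M. qbinom q (Suc M) m * ?f a m)
      = (\<Sum>m\<le>M. qbinom q M m * ?f a m) - q ^ (M + Suc t) * (\<Sum>m\<le>M. qbinom q M m * ?f (Suc a) m)"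
    unfolding sum_qbinom_Suc sum_distrib_left diff_conv_add_uminus sum_negf[symmetric]
    by (intro arg_cong2[where f = "(+)"] sum.cong refl) simp
  also have "\<dots> = qpoch q q a * qpoch q q (M + t) / (qpoch q q t * qpoch q q (M + a + Suc t))
      - q ^ (M + Suc t) * (qpoch q q (Suc a) * qpoch q q (M + t) / (qpoch q q t * qpoch q q (M + Suc a + Suc t)))"
    unfolding Suc ..
  also have "\<dots> = qpoch q q a * qpoch q q (Suc M + t) / (qpoch q q t * qpoch q q (Suc M + a + Suc t))"
  proof -
    define P where "P = qpoch q q (M + a + Suc t)"
    have P: "qpoch q q (M + Suc a + Suc t) = P * (1 - q ^ (M + a + t + 2))"
      "qpoch q q (Suc M + a + Suc t) = P * (1 - q ^ (M + a + t + 2))"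
      by (simp_all add: P_def qpoch_Suc)
    have nz: "qpoch q q t \<noteq> 0" "P \<noteq> 0" "1 - q ^ (M + a + t + 2) \<noteq> 0"
      using qpoch_nonzero[OF assms assms] one_minus_power_nonzero[OF assms, of "M + a + t + 2"]
      by (simp_all add: P_def)
    have T: "qpoch q q (Suc M + t) = qpoch q q (M + t) * (1 - q ^ (M + Suc t))"
      by (simp add: qpoch_Suc)
    \<comment> \<open>With U = q^(M+t+1) and V = q^(a+1) the claim reduces to (1 - U V) - U (1 - V)
      = 1 - U.\<close>
    have E: "q ^ (M + a + t + 2) = q ^ (M + Suc t) * q ^ Suc a"
      by (simp add: ac_simps flip: power_add)
    show ?thesis
      using nz unfolding P P_def[symmetric] T qfact_Suc[of q a]
      unfolding E by (simp add: divide_simps) (simp add: algebra_simps)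
  qed
  finally show ?case .
qed

section \<open>Bailey's transform\<close>

text \<open>Setting \<open>1 / (q;q)\<^bsub>n-r\<^esub>\<close> to zero for \<open>r > n\<close> keeps the recurrences below valid
  without side conditions and makes all sums terminate naturally.\<close>

definition recip_qfact :: "complex \<Rightarrow> nat \<Rightarrow> nat \<Rightarrow> complex" where
  "recip_qfact q n r = (if r \<le> n then 1 / qpoch q q (n - r) else 0)"

lemma recip_qfact_eq_0: "n < r \<Longrightarrow> recip_qfact q n r = 0"
  by (simp add: recip_qfact_def)

lemma recip_qfact_Suc_Suc: "recip_qfact q (Suc n) (Suc r) = recip_qfact q n r"
  by (simp add: recip_qfact_def)

text \<open>This is 1/(q;q)_(n-r) = (1 - q^(n+1-r)) / (q;q)_(n+1-r) multiplied by q^r, which keeps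
  subtraction out of the exponents. At r = n + 1 both sides vanish.\<close>

lemma recip_qfact_Suc_left:
  assumes "norm q < 1"
  shows "q ^ r * recip_qfact q n r = (q ^ r - q ^ Suc n) * recip_qfact q (Suc n) r"
proof (cases "r \<le> n")
  case True
  then obtain d where n: "n = r + d" by (metis le_Suc_ex)
  have "1 - q ^ Suc d \<noteq> 0" "qpoch q q d \<noteq> 0"
    using one_minus_power_nonzero[OF assms, of "Suc d"] qpoch_nonzero[OF assms assms]
    by (simp_all del: power_Suc)
  moreover have "q ^ r - q ^ Suc n = q ^ r * (1 - q ^ Suc d)"
    by (simp add: n power_add algebra_simps)
  ultimately show ?thesis
    by (simp add: recip_qfact_def n Suc_diff_le qfact_Suc del: power_Suc)
qed (auto simp: recip_qfact_def not_le le_Suc_eq)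

lemma recip_qfact_Suc_right:
  assumes "norm q < 1"
  shows "q ^ r * recip_qfact q n (Suc r) = (q ^ r - q ^ n) * recip_qfact q n r"
proof (cases n)
  case (Suc m)
  then show ?thesis
    using recip_qfact_Suc_left[OF assms, of r m] by (simp add: recip_qfact_Suc_Suc)
qed (auto simp: recip_qfact_def)

lemma sum_atMost_add_eq:
  fixes g :: "nat \<Rightarrow> complex"
  assumes "\<And>n. n < r \<Longrightarrow> g n = 0"
  shows "(\<Sum>n\<le>M + r. g n) = (\<Sum>m\<le>M. g (m + r))"
proof (induction M)
  case 0
  have "{..r} = insert r {..<r}" by auto
  with assms show ?case by simp
qed simp

lemma choose_two_Suc_add: "Suc (m + r) choose 2 = (Suc m choose 2) + (Suc r choose 2) + m * r"
  by (induction m) (simp_all add: Suc_Suc_choose_two del: binomial_Suc_Suc)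

text \<open>The limit of (\<rho>;q)_n (a/\<rho>)^n as \<rho> tends to infinity, for a =
  q^(l+1).\<close>

definition bailey_weight :: "complex \<Rightarrow> nat \<Rightarrow> nat \<Rightarrow> complex" where
  "bailey_weight q l n = (-1) ^ n * q ^ ((Suc n choose 2) + l * n)"

text \<open>The substitution n = m + r, N = M + r turns this into the q-Chu--Vandermonde sum with a
  = r and t = r + l; the cross term m r of the triangular numbers is what enlarges t from l to r +
  l.\<close>

lemma bailey_inner_sum:
  assumes "norm q < 1"
  shows "(\<Sum>n\<le>N. bailey_weight q l n * qpoch q q n * recip_qfact q N n
            * (recip_qfact q n r / qpoch q q (n + r + Suc l)))
       = bailey_weight q l r * (qpoch q q r / qpoch q q (r + l))
            * (qpoch q q (N + l) / qpoch q q (N + r + Suc l)) * recip_qfact q N r"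
proof (cases "r \<le> N")
  case True
  then obtain M where N: "N = M + r" by (metis le_Suc_ex add.commute)
  have nz: "qpoch q q n \<noteq> 0" for n using assms qpoch_nonzero by blast
  let ?W = "bailey_weight q l r / qpoch q q M"
  have "bailey_weight q l (m + r) * qpoch q q (m + r) * recip_qfact q N (m + r)
            * (recip_qfact q (m + r) r / qpoch q q (m + r + r + Suc l))
     = ?W * (qbinom q M m * ((-1) ^ m * q ^ ((Suc m choose 2) + m * (r + l))
            * (qpoch q q (m + r) / qpoch q q (m + r + Suc (r + l)))))"
    if "m \<le> M" for m
  proof -
    \<comment> \<open>The Gaussian binomial arises from the product of the two truncating
      reciprocals, 1/(q;q)_(M-m) and 1/(q;q)_m.\<close>
    have "qbinom q M m = qpoch q q M / (qpoch q q m * qpoch q q (M - m))"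
      using qbinom_qfact[OF that, of q] nz by (simp add: field_simps)
    moreover have "bailey_weight q l (m + r)
        = bailey_weight q l r * ((-1) ^ m * q ^ ((Suc m choose 2) + m * (r + l)))"
      by (simp add: bailey_weight_def choose_two_Suc_add power_add algebra_simps)
    moreover have "recip_qfact q N (m + r) = 1 / qpoch q q (M - m)"
      "recip_qfact q (m + r) r = 1 / qpoch q q m"
      using that by (simp_all add: recip_qfact_def N)
    ultimately show ?thesis using nz by (simp add: add_ac mult_ac)
  qed
  then have "(\<Sum>n\<le>N. bailey_weight q l n * qpoch q q n * recip_qfact q N n
            * (recip_qfact q n r / qpoch q q (n + r + Suc l)))
     = ?W * (\<Sum>m\<le>M. qbinom q M m * ((-1) ^ m * q ^ ((Suc m choose 2) + m * (r + l))
            * (qpoch q q (m + r) / qpoch q q (m + r + Suc (r + l)))))"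
    unfolding N sum_distrib_left
    by (subst sum_atMost_add_eq) (auto simp: recip_qfact_eq_0 intro!: sum.cong)
  also have "\<dots> = ?W * (qpoch q q r * qpoch q q (M + (r + l)) / (qpoch q q (r + l) * qpoch q q (M + r + Suc (r + l))))"
    unfolding q_Chu_Vandermonde[OF assms] ..
  also have "\<dots> = bailey_weight q l r * (qpoch q q r / qpoch q q (r + l))
            * (qpoch q q (N + l) / qpoch q q (N + r + Suc l)) * recip_qfact q N r"
    by (simp add: N recip_qfact_def ac_simps)
  finally show ?thesis .
next
  case False
  then have "recip_qfact q N n = 0 \<or> recip_qfact q n r = 0" for n
    by (auto simp: recip_qfact_def)
  then have "(\<Sum>n\<le>N. bailey_weight q l n * qpoch q q n * recip_qfact q N n
            * (recip_qfact q n r / qpoch q q (n + r + Suc l))) = 0"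
    by (intro sum.neutral) auto
  with False show ?thesis by (simp add: recip_qfact_eq_0)
qed

text \<open>Since \<open>recip_qfact q n r\<close> vanishes for r > n, the inner sums may all run up
  to N, and the order of summation can be exchanged.\<close>

lemma finite_bailey_transform:
  assumes "norm q < 1"
  assumes \<beta>: "\<And>n. \<beta> n = (\<Sum>r\<le>n. \<alpha> r * (recip_qfact q n r / qpoch q q (n + r + Suc l)))"
  shows "(\<Sum>n\<le>N. bailey_weight q l n * qpoch q q n * \<beta> n * recip_qfact q N n)
       = (\<Sum>r\<le>N. bailey_weight q l r * (qpoch q q r / qpoch q q (r + l)) * \<alpha> r
            * (qpoch q q (N + l) / qpoch q q (N + r + Suc l)) * recip_qfact q N r)"
proof -
  have "\<beta> n = (\<Sum>r\<le>N. \<alpha> r * (recip_qfact q n r / qpoch q q (n + r + Suc l)))" if "n \<le> N" for n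
    unfolding \<beta> using that by (intro sum.mono_neutral_left) (auto simp: recip_qfact_eq_0)
  then have "(\<Sum>n\<le>N. bailey_weight q l n * qpoch q q n * \<beta> n * recip_qfact q N n)
      = (\<Sum>n\<le>N. \<Sum>r\<le>N. \<alpha> r * (bailey_weight q l n * qpoch q q n * recip_qfact q N n
            * (recip_qfact q n r / qpoch q q (n + r + Suc l))))"
    by (intro sum.cong refl) (simp add: sum_distrib_left sum_distrib_right algebra_simps)
  also have "\<dots> = (\<Sum>r\<le>N. \<alpha> r * (\<Sum>n\<le>N. bailey_weight q l n * qpoch q q n * recip_qfact q N n
            * (recip_qfact q n r / qpoch q q (n + r + Suc l))))"
    by (subst sum.swap) (simp add: sum_distrib_left)
  finally show ?thesis
    unfolding bailey_inner_sum[OF assms(1)] by (simp add: mult_ac)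
qed

section \<open>Passage to the limit\<close>

lemma tendsto_recip_qfact:
  assumes "qpoch q q \<longlonglongrightarrow> L" "L \<noteq> 0"
  shows "(\<lambda>N. recip_qfact q N r) \<longlonglongrightarrow> 1 / L"
proof -
  have "(\<lambda>N. 1 / qpoch q q (N - r)) \<longlonglongrightarrow> 1 / L"
    using assms by (intro tendsto_intros filterlim_compose[OF _ filterlim_minus_const_nat_at_top]) auto
  moreover have "eventually (\<lambda>N. 1 / qpoch q q (N - r) = recip_qfact q N r) sequentially"
    using eventually_ge_at_top[of r] by eventually_elim (simp add: recip_qfact_def)
  ultimately show ?thesis by (rule Lim_transform_eventually)
qed

text \<open>The cut-off \<open>u k N = 0\<close> for N < k turns each partial sum into a full
  series, and \<open>norm (f k) * C\<close> is a summable majorant uniform in N.\<close>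

lemma tannery_mult:
  fixes f :: "nat \<Rightarrow> complex" and u :: "nat \<Rightarrow> nat \<Rightarrow> complex"
  assumes "summable (\<lambda>k. norm (f k))" "\<And>k. u k \<longlonglongrightarrow> 1" "\<And>k N. norm (u k N) \<le> C"
    and "\<And>k N. N < k \<Longrightarrow> u k N = 0"
  shows "(\<lambda>N. \<Sum>k\<le>N. f k * u k N) \<longlonglongrightarrow> suminf f"
proof -
  have "(\<lambda>N. \<Sum>k. f k * u k N) \<longlonglongrightarrow> suminf f"
  proof (rule tannerys_theorem[where M = "\<lambda>k. norm (f k) * C", THEN conjunct2, THEN conjunct2])
    show "(\<lambda>N. f k * u k N) \<longlonglongrightarrow> f k" for k
      using tendsto_mult[OF tendsto_const assms(2)] by simp
    show "\<forall>\<^sub>F (k, N) in sequentially \<times>\<^sub>F sequentially. norm (f k * u k N) \<le> norm (f k) * C"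
      by (intro always_eventually) (auto simp: norm_mult intro!: mult_left_mono assms)
    show "summable (\<lambda>k. norm (f k) * C)"
      by (intro summable_mult2 assms)
  qed simp
  moreover have "(\<Sum>k. f k * u k N) = (\<Sum>k\<le>N. f k * u k N)" for N
    by (intro suminf_finite) (auto simp: assms(4))
  ultimately show ?thesis by simp
qed

text \<open>This is the limiting case \<open>\<rho>\<^sub>1 = q\<close>, \<open>\<rho>\<^sub>2 \<rightarrow> \<infinity>\<close> of Bailey's lemma for pairs relative to \<open>a = q\<^bsup>l+1\<^esup>\<close>.\<close>

lemma bailey_transform:
  assumes "norm q < 1"
  assumes \<beta>: "\<And>n. \<beta> n = (\<Sum>r\<le>n. \<alpha> r * (recip_qfact q n r / qpoch q q (n + r + Suc l)))"
  assumes "summable (\<lambda>n. norm (bailey_weight q l n * qpoch q q n * \<beta> n))"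
  assumes "summable (\<lambda>r. norm (bailey_weight q l r * (qpoch q q r / qpoch q q (r + l)) * \<alpha> r))"
  shows "(\<Sum>n. bailey_weight q l n * qpoch q q n * \<beta> n)
       = (\<Sum>r. bailey_weight q l r * (qpoch q q r / qpoch q q (r + l)) * \<alpha> r)"
proof -
  obtain L where L: "L \<noteq> 0" "qpoch q q \<longlonglongrightarrow> L"
    using qpoch_tendsto[OF assms(1,1)] .
  obtain K K' where K: "\<And>n. norm (qpoch q q n) \<le> K" and "K' > 0" and "\<And>n. norm (1 / qpoch q q n) \<le> K'"
    using qpoch_Bseq[OF assms(1,1)] unfolding Bseq_def by blast
  then have K': "norm (recip_qfact q n r) \<le> K'" "norm (1 / qpoch q q n) \<le> K'" for n r
    by (auto simp: recip_qfact_def)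
  have "K \<ge> 0" using K[of 0] by simp
  have shift: "(\<lambda>N. qpoch q q (N + k)) \<longlonglongrightarrow> L" for k
    using L(2) by (rule LIMSEQ_ignore_initial_segment)
  note rq = tendsto_recip_qfact[OF L(2,1)]
  \<comment> \<open>The truncation factor tends to 1 / L; multiplying the finite identity by
    \<open>qpoch q q N\<close> normalises its limit to 1.\<close>
  have 1: "(\<lambda>N. \<Sum>n\<le>N. bailey_weight q l n * qpoch q q n * \<beta> n * (qpoch q q N * recip_qfact q N n))
      \<longlonglongrightarrow> (\<Sum>n. bailey_weight q l n * qpoch q q n * \<beta> n)"
  proof (rule tannery_mult[where C = "K * K'"])
    show "(\<lambda>N. qpoch q q N * recip_qfact q N n) \<longlonglongrightarrow> 1" for n
      using tendsto_mult[OF L(2) rq] L(1) by simp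
    show "norm (qpoch q q N * recip_qfact q N n) \<le> K * K'" for n N
      unfolding norm_mult by (intro mult_mono K K' \<open>K \<ge> 0\<close> norm_ge_zero)
  qed (use assms in \<open>simp_all add: recip_qfact_eq_0\<close>)
  have 2: "(\<lambda>N. \<Sum>r\<le>N. bailey_weight q l r * (qpoch q q r / qpoch q q (r + l)) * \<alpha> r
        * (qpoch q q N * recip_qfact q N r * (qpoch q q (N + l) * (1 / qpoch q q (N + r + Suc l)))))
      \<longlonglongrightarrow> (\<Sum>r. bailey_weight q l r * (qpoch q q r / qpoch q q (r + l)) * \<alpha> r)"
  proof (rule tannery_mult[where C = "K * K' * (K * K')"])
    have "(\<lambda>N. qpoch q q N * recip_qfact q N r * (qpoch q q (N + l) * (1 / qpoch q q (N + (r + Suc l)))))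
        \<longlonglongrightarrow> L * (1 / L) * (L * (1 / L))" for r
      using L(1) by (intro tendsto_intros L(2) rq shift)
    then show "(\<lambda>N. qpoch q q N * recip_qfact q N r * (qpoch q q (N + l) * (1 / qpoch q q (N + r + Suc l))))
        \<longlonglongrightarrow> 1" for r
      using L(1) by (simp add: add.assoc)
    show "norm (qpoch q q N * recip_qfact q N r * (qpoch q q (N + l) * (1 / qpoch q q (N + r + Suc l))))
        \<le> K * K' * (K * K')" for r N
      unfolding norm_mult using \<open>K' > 0\<close>
      by (intro mult_mono K K' \<open>K \<ge> 0\<close> norm_ge_zero mult_nonneg_nonneg less_imp_le)
  qed (use assms in \<open>simp_all add: recip_qfact_eq_0\<close>)
  have "(\<Sum>n\<le>N. bailey_weight q l n * qpoch q q n * \<beta> n * (qpoch q q N * recip_qfact q N n))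
      = (\<Sum>r\<le>N. bailey_weight q l r * (qpoch q q r / qpoch q q (r + l)) * \<alpha> r
        * (qpoch q q N * recip_qfact q N r * (qpoch q q (N + l) * (1 / qpoch q q (N + r + Suc l)))))" for N
    using arg_cong[OF finite_bailey_transform[OF assms(1) \<beta>, of N], of "\<lambda>x. qpoch q q N * x"]
    by (simp add: sum_distrib_left mult_ac)
  with 1 2 show ?thesis
    using LIMSEQ_unique by simp
qed

section \<open>Bailey pairs\<close>

text \<open>The WZ method: summing \<open>rec\<close> over r telescopes the right-hand side to zero,
  so the sums satisfy the same first-order recurrence in n as \<open>b\<close>, with the same
  initial value.\<close>

lemma bailey_pair_by_telescoping:
  fixes F G :: "nat \<Rightarrow> nat \<Rightarrow> complex"
  assumes rec: "\<And>n r. c n * F (Suc n) r - F n r = G n (Suc r) - G n r"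
    and G: "\<And>n. G n 0 = 0" "\<And>n r. Suc n < r \<Longrightarrow> G n r = 0"
    and F: "\<And>n r. n < r \<Longrightarrow> F n r = 0"
    and b: "F 0 0 = b 0" "\<And>n. b n = c n * b (Suc n)" "\<And>n. c n \<noteq> 0"
  shows "(\<Sum>r\<le>n. F n r) = b n"
proof (induction n)
  case (Suc n)
  \<comment> \<open>The range goes up to n + 1, which adds only \<open>F n (Suc n) = 0\<close> to
    the second sum; the telescoping ends at \<open>G n (n + 2) = 0\<close>.\<close>
  have "c n * (\<Sum>r\<le>Suc n. F (Suc n) r) - (\<Sum>r\<le>Suc n. F n r) = (\<Sum>r<Suc (Suc n). G n (Suc r) - G n r)"
    by (simp only: lessThan_Suc_atMost flip: rec) (simp add: sum_subtractf sum_distrib_left algebra_simps)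
  also have "\<dots> = 0"
    by (subst sum_lessThan_telescope) (simp add: G)
  finally have "c n * (\<Sum>r\<le>Suc n. F (Suc n) r) = c n * b (Suc n)"
    using Suc b(2)[of n] by (simp add: F)
  then show ?case using b(3) by simp
qed (simp add: b(1))

text \<open>In this divided form every term of a WZ recurrence is a rational function of powers of q
  times one shared reciprocal factorial.\<close>

lemma recip_qfact_Suc_left':
  assumes "norm q < 1" "q \<noteq> 0"
  shows "recip_qfact q n r = (1 - q ^ Suc n / q ^ r) * recip_qfact q (Suc n) r"
  using recip_qfact_Suc_left[OF assms(1), of r n] assms(2)
  by (simp add: field_simps del: power_Suc)

lemma recip_qfact_Suc_right':
  assumes "norm q < 1" "q \<noteq> 0"
  shows "recip_qfact q n (Suc r) = (1 - q ^ n / q ^ r) * recip_qfact q n r"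
  using recip_qfact_Suc_right[OF assms(1), of r n] assms(2)
  by (simp add: field_simps del: power_Suc)

lemma inverse_qfact_Suc:
  assumes "norm q < 1"
  shows "1 / qpoch q q n = (1 - q ^ Suc n) * (1 / qpoch q q (Suc n))"
  using one_minus_power_nonzero[OF assms, of "Suc n"] by (simp add: qfact_Suc del: power_Suc)

text \<open>Relative to a = q^2 the entry at index 2j of the Bailey pair is
  \<open>alpha1 q j * (1 - q ^ (4 * j + 2))\<close>, and odd entries vanish. Relative to a = q the
  two parts of this product sit at the indices 2j and 2j + 1.\<close>

definition alpha1 :: "complex \<Rightarrow> nat \<Rightarrow> complex" where
  "alpha1 q j = (-1) ^ j * q ^ (3 * j\<^sup>2 + j)"

lemma alpha1_Suc: "alpha1 q (Suc j) = - alpha1 q j * q ^ 4 * (q ^ (2 * j)) ^ 3"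
proof -
  have "q ^ (3 * (Suc j)\<^sup>2 + Suc j) = q ^ (3 * j\<^sup>2 + j) * q ^ 4 * (q ^ (2 * j)) ^ 3"
    unfolding power_mult[symmetric] power_add[symmetric] by (simp add: power2_eq_square algebra_simps)
  then show ?thesis by (simp add: alpha1_def)
qed

text \<open>The next three lemmas are the rational-function identities behind WZ certificates.
  There \<open>X = q\<^bsup>j\<^esup>\<close>, \<open>Z = q\<^bsup>2j\<^esup>\<close>, \<open>Y\<close> is the base raised to the power \<open>n + 1\<close>, and \<open>A\<close>, \<open>P\<close> are the
  reciprocal \<open>q\<close>-factorials shared by all terms.\<close>

lemma telescoping_certificate1:
  fixes q Y Z A P E :: complex
  assumes "q \<noteq> 0" "Z \<noteq> 0"
  shows "(1 - Y) * (1 - q * Y\<^sup>2) * (E * (1 - q\<^sup>2 * Z\<^sup>2) * (A * P))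
      - E * (1 - q\<^sup>2 * Z\<^sup>2) * ((1 - Y / Z) * A * ((1 - q\<^sup>2 * Y * Z) * P))
     = - E * q ^ 4 * Z ^ 3 * (- Y * (1 - q\<^sup>2 * Z) / (q\<^sup>2 * Z)) * ((1 - Y / (q * Z)) * ((1 - Y / Z) * A) * P)
      - E * (- Y * (1 - Z) / Z) * (A * ((1 - q * Y * Z) * ((1 - q\<^sup>2 * Y * Z) * P)))"
proof -
  \<comment> \<open>Expressing Y through v clears all denominators, leaving a polynomial identity
    for \<open>algebra\<close>.\<close>
  define v where "v = Y / (q * Z)"
  have Y: "Y = q * v * Z" using assms by (simp add: v_def)
  have "Y / Z = q * v" "Y / (q * Z) = v" "- Y * (1 - Z) / Z = - (q * v) * (1 - Z)"
    "q ^ 4 * Z ^ 3 * (- Y * (1 - q\<^sup>2 * Z) / (q\<^sup>2 * Z)) = - (q ^ 3 * Z ^ 3 * v * (1 - q\<^sup>2 * Z))"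
    using assms by (simp_all add: Y power2_eq_square power4_eq_xxxx power3_eq_cube)
  note d = this(1-3) this(4)[THEN arg_cong, of "\<lambda>x. - E * x", unfolded mult.assoc[symmetric]]
  show ?thesis
    unfolding mult.assoc[symmetric] d unfolding Y by algebra
qed

lemma telescoping_certificate2:
  fixes q Y X A P E :: complex
  assumes "q \<noteq> 0" "X \<noteq> 0"
  defines "h \<equiv> \<lambda>X. - Y / X\<^sup>2 - Y\<^sup>2 / q / X + (Y\<^sup>2 - Y / q) * (1 - X) + Y\<^sup>2 / q * X\<^sup>2 + Y * X ^ 3"
  shows "(1 - Y\<^sup>2) * (1 + Y / q) * (E * (1 - q\<^sup>2 * X ^ 4) * (A * P))
      - E * (1 - q\<^sup>2 * X ^ 4) * ((1 - Y / X\<^sup>2) * A * ((1 - q\<^sup>2 * Y * X\<^sup>2) * P))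
     = - E * q * X ^ 3 * h (q * X) * ((1 - Y / X\<^sup>2) * A * P)
      - E * h X * (A * ((1 - q\<^sup>2 * Y * X\<^sup>2) * P))"
proof -
  \<comment> \<open>The deepest denominator, q^2 X^2 in \<open>h (q * X)\<close>, is absorbed into
    w; everything else then becomes polynomial.\<close>
  define w where "w = Y / (q\<^sup>2 * X\<^sup>2)"
  have Y: "Y = q\<^sup>2 * w * X\<^sup>2" using assms(1,2) by (simp add: w_def)
  have "Y / X\<^sup>2 = q\<^sup>2 * w" "Y / q = q * w * X\<^sup>2"
    "h X = - (q\<^sup>2 * w) - q ^ 3 * w\<^sup>2 * X ^ 3 + (Y\<^sup>2 - q * w * X\<^sup>2) * (1 - X)
        + q ^ 3 * w\<^sup>2 * X ^ 6 + Y * X ^ 3"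
    "h (q * X) = - w - q\<^sup>2 * w\<^sup>2 * X ^ 3 + (Y\<^sup>2 - q * w * X\<^sup>2) * (1 - q * X)
        + q ^ 5 * w\<^sup>2 * X ^ 6 + q ^ 3 * Y * X ^ 3"
    using assms(1,2) by (simp_all add: h_def Y field_simps eval_nat_numeral)
  note d = this
  show ?thesis unfolding d unfolding Y by algebra
qed

lemma telescoping_certificate3:
  fixes q Y X A P E :: complex
  assumes "q \<noteq> 0" "X \<noteq> 0"
  defines "h \<equiv> \<lambda>X. - Y / X\<^sup>2 - Y\<^sup>2 / X + Y\<^sup>2 + Y * X"
  shows "(1 - Y\<^sup>2) * (1 + q * Y) * (E * (1 - q * X\<^sup>2) * (A * P))
      - E * (1 - q * X\<^sup>2) * ((1 - Y / X\<^sup>2) * A * ((1 - q\<^sup>2 * Y * X\<^sup>2) * P))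
     = - E * q\<^sup>2 * X ^ 3 * h (q * X) * ((1 - Y / X\<^sup>2) * A * P)
      - E * h X * (A * ((1 - q\<^sup>2 * Y * X\<^sup>2) * P))"
proof -
  define w where "w = Y / (q\<^sup>2 * X\<^sup>2)"
  have Y: "Y = q\<^sup>2 * w * X\<^sup>2" using assms(1,2) by (simp add: w_def)
  have "Y / X\<^sup>2 = q\<^sup>2 * w"
    "h X = - (q\<^sup>2 * w) - q ^ 4 * w\<^sup>2 * X ^ 3 + Y\<^sup>2 + Y * X"
    "h (q * X) = - w - q ^ 3 * w\<^sup>2 * X ^ 3 + Y\<^sup>2 + q * Y * X"
    using assms(1,2) by (simp_all add: h_def Y field_simps eval_nat_numeral)
  note d = this
  show ?thesis unfolding d unfolding Y by algebra
qed

text \<open>WZ telescoping in j, where \<open>c n\<close> is the ratio of the right-hand sides at n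
  and n + 1. The factor 1 - q^(2j) in \<open>G\<close> makes \<open>G n 0\<close> vanish, and terms
  with 2j > n are zero.\<close>

lemma bailey_pair1:
  assumes "norm q < 1" "q \<noteq> 0"
  shows "(\<Sum>j\<le>n. alpha1 q j * (1 - q ^ (4 * j + 2)) * (recip_qfact q n (2 * j) * (1 / qpoch q q (n + 2 * j + 2))))
       = 1 / (qpoch q q n * qpoch q (q\<^sup>2) (Suc n))"
proof (rule bailey_pair_by_telescoping[where c = "\<lambda>n. (1 - q ^ Suc n) * (1 - q * (q ^ Suc n)\<^sup>2)"
      and G = "\<lambda>n j. alpha1 q j * (- (q ^ Suc n) * (1 - q ^ (2 * j)) / q ^ (2 * j))
                * (recip_qfact q (Suc n) (2 * j) * (1 / qpoch q q (n + 1 + 2 * j)))"])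
  fix n j
  define Y Z where YZ: "Y = q ^ Suc n" "Z = q ^ (2 * j)"
  note rl = recip_qfact_Suc_left'[OF assms] and rr = recip_qfact_Suc_right'[OF assms]
  \<comment> \<open>\<open>A\<close> and \<open>P\<close> are chosen so that all four terms of the
    recurrence are polynomial or rational multiples of \<open>A * P\<close>; n + 2j + 3 is the
    largest factorial index that occurs.\<close>
  define A where "A = recip_qfact q (Suc n) (2 * j)"
  define P where "P = 1 / qpoch q q (n + 2 * j + 3)"
  have p2: "1 / qpoch q q (n + 2 * j + 2) = (1 - q\<^sup>2 * Y * Z) * P"
    unfolding P_def by (subst inverse_qfact_Suc[OF assms(1)])
      (simp add: YZ numeral_3_eq_3 power_add power2_eq_square)
  have p1: "1 / qpoch q q (n + 1 + 2 * j) = (1 - q * Y * Z) * ((1 - q\<^sup>2 * Y * Z) * P)"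
    unfolding p2[symmetric] by (subst inverse_qfact_Suc[OF assms(1)])
      (simp add: YZ power_add power2_eq_square)
  have q4: "q ^ (4 * j + 2) = q\<^sup>2 * Z\<^sup>2"
    unfolding YZ power_mult[symmetric] power_add[symmetric] by (simp add: ac_simps)
  have sh: "2 * Suc j = Suc (Suc (2 * j))" by simp
  have a2: "recip_qfact q (Suc n) (2 * Suc j) = (1 - Y / (q * Z)) * ((1 - Y / Z) * A)"
    unfolding sh rr[of "Suc n"] A_def YZ by (simp add: mult_ac)
  have a1: "recip_qfact q n (2 * j) = (1 - Y / Z) * A"
    unfolding A_def YZ by (rule rl)
  have z: "q ^ (2 * Suc j) = q\<^sup>2 * Z" by (simp add: YZ power2_eq_square)
  have e: "Suc n + 2 * j + 2 = n + 2 * j + 3" "n + 1 + 2 * Suc j = n + 2 * j + 3" by simp_all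
  show "(1 - q ^ Suc n) * (1 - q * (q ^ Suc n)\<^sup>2)
      * (alpha1 q j * (1 - q ^ (4 * j + 2)) * (recip_qfact q (Suc n) (2 * j) * (1 / qpoch q q (Suc n + 2 * j + 2))))
    - alpha1 q j * (1 - q ^ (4 * j + 2)) * (recip_qfact q n (2 * j) * (1 / qpoch q q (n + 2 * j + 2)))
    = alpha1 q (Suc j) * (- (q ^ Suc n) * (1 - q ^ (2 * Suc j)) / q ^ (2 * Suc j))
        * (recip_qfact q (Suc n) (2 * Suc j) * (1 / qpoch q q (n + 1 + 2 * Suc j)))
    - alpha1 q j * (- (q ^ Suc n) * (1 - q ^ (2 * j)) / q ^ (2 * j))
        * (recip_qfact q (Suc n) (2 * j) * (1 / qpoch q q (n + 1 + 2 * j)))"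
    unfolding e p1 p2 q4 a2 a1 z alpha1_Suc unfolding P_def[symmetric] A_def[symmetric] YZ[symmetric]
    by (rule telescoping_certificate1) (use assms(2) in \<open>auto simp: YZ\<close>)
next
  show "alpha1 q 0 * (1 - q ^ (4 * 0 + 2)) * (recip_qfact q 0 (2 * 0) * (1 / qpoch q q (0 + 2 * 0 + 2)))
      = 1 / (qpoch q q 0 * qpoch q (q\<^sup>2) (Suc 0))"
    using one_minus_power_nonzero[OF assms(1), of 2]
    by (simp add: alpha1_def recip_qfact_def qpoch_def numeral_2_eq_2 power2_eq_square)
  show nz: "(1 - q ^ Suc n) * (1 - q * (q ^ Suc n)\<^sup>2) \<noteq> 0" for n
    using one_minus_power_nonzero[OF assms(1), of "Suc n"] one_minus_power_nonzero[OF assms(1), of "Suc (Suc n * 2)"]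
    unfolding mult_eq_0_iff power_mult[symmetric] power_Suc[symmetric] by blast
  show "1 / (qpoch q q n * qpoch q (q\<^sup>2) (Suc n))
      = (1 - q ^ Suc n) * (1 - q * (q ^ Suc n)\<^sup>2) * (1 / (qpoch q q (Suc n) * qpoch q (q\<^sup>2) (Suc (Suc n))))" for n
  proof -
    have "q\<^sup>2 ^ Suc n = (q ^ Suc n)\<^sup>2"
      by (metis power_mult mult.commute)
    then show ?thesis
      using nz[of n] by (simp add: qfact_Suc qpoch_Suc[of _ _ "Suc n"] del: power_Suc)
  qed
qed (simp_all add: recip_qfact_eq_0)

text \<open>One family for both pairs in base q^2: k = 1 belongs to (-q;q)_(2n) and k = 2 to
  (-q;q)_(2n+1).\<close>

definition alpha2 :: "complex \<Rightarrow> nat \<Rightarrow> nat \<Rightarrow> complex" where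
  "alpha2 q k j = (-1) ^ j * q ^ (3 * (j choose 2) + k * j)"

lemma alpha2_Suc: "alpha2 q k (Suc j) = - alpha2 q k j * q ^ k * (q ^ j) ^ 3"
proof -
  have "q ^ (3 * (Suc j choose 2) + k * Suc j) = q ^ (3 * (j choose 2) + k * j) * q ^ k * (q ^ j) ^ 3"
    unfolding power_mult[symmetric] power_add[symmetric] by (simp add: numeral_2_eq_2 algebra_simps)
  then show ?thesis by (simp add: alpha2_def)
qed

section \<open>Bailey pairs in base q^2\<close>

context
  fixes q Q :: complex
  assumes q: "norm q < 1" "q \<noteq> 0" and Q: "Q = q\<^sup>2"
begin

lemma Q_norm: "norm Q < 1" "Q \<noteq> 0"
  using q by (simp_all add: Q norm_power power_less_one_iff)

lemma one_plus_power_nonzero: "1 + q ^ Suc i \<noteq> 0"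
  using one_minus_mult_power_nonzero[of "- q" q i] q by simp

text \<open>The shifts are written in X = q^j instead of Q^j = X^2, because the \<alpha> entries and
  the certificates involve odd powers of X.\<close>

lemma square_base_shift:
  "recip_qfact Q n j = (1 - Q ^ Suc n / (q ^ j)\<^sup>2) * recip_qfact Q (Suc n) j"
  "recip_qfact Q (Suc n) (Suc j) = (1 - Q ^ Suc n / (q ^ j)\<^sup>2) * recip_qfact Q (Suc n) j"
  "1 / qpoch Q Q (n + j + 1) = (1 - q\<^sup>2 * Q ^ Suc n * (q ^ j)\<^sup>2) * (1 / qpoch Q Q (n + j + 2))"
proof -
  have X: "Q ^ j = (q ^ j)\<^sup>2" by (simp add: Q mult.commute flip: power_mult)
  show "recip_qfact Q n j = (1 - Q ^ Suc n / (q ^ j)\<^sup>2) * recip_qfact Q (Suc n) j"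
    unfolding X[symmetric] by (rule recip_qfact_Suc_left'[OF Q_norm])
  show "recip_qfact Q (Suc n) (Suc j) = (1 - Q ^ Suc n / (q ^ j)\<^sup>2) * recip_qfact Q (Suc n) j"
    unfolding X[symmetric] by (rule recip_qfact_Suc_right'[OF Q_norm])
  show "1 / qpoch Q Q (n + j + 1) = (1 - q\<^sup>2 * Q ^ Suc n * (q ^ j)\<^sup>2) * (1 / qpoch Q Q (n + j + 2))"
    unfolding X[symmetric] Q[symmetric]
    by (subst inverse_qfact_Suc[OF Q_norm(1)]) (simp add: power_add)
qed

text \<open>WZ telescoping with Y = Q^(n+1). The certificate \<open>h\<close> vanishes at X = 1,
  that is at j = 0, as the telescoping requires.\<close>

lemma bailey_pair2:
  "(\<Sum>j\<le>n. alpha2 q 1 j * (1 - q ^ (4 * j + 2)) * (recip_qfact Q n j * (1 / qpoch Q Q (n + j + 1))))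
       = 1 / (qpoch Q Q n * qpoch (- q) q (2 * n))"
proof -
  define h where "h = (\<lambda>(Y::complex) X. - Y / X\<^sup>2 - Y\<^sup>2 / q / X + (Y\<^sup>2 - Y / q) * (1 - X) + Y\<^sup>2 / q * X\<^sup>2 + Y * X ^ 3)"
  show ?thesis
  proof (rule bailey_pair_by_telescoping[where c = "\<lambda>n. (1 - (Q ^ Suc n)\<^sup>2) * (1 + Q ^ Suc n / q)"
        and G = "\<lambda>n j. alpha2 q 1 j * h (Q ^ Suc n) (q ^ j) * (recip_qfact Q (Suc n) j * (1 / qpoch Q Q (n + j + 1)))"])
    fix n j
    have q4: "q ^ (4 * j + 2) = q\<^sup>2 * (q ^ j) ^ 4"
      unfolding power_mult[symmetric] power_add[symmetric] power_Suc[symmetric] by (simp add: ac_simps)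
    have e: "Suc n + j + 1 = n + j + 2" "n + Suc j + 1 = n + j + 2" by simp_all
    show "(1 - (Q ^ Suc n)\<^sup>2) * (1 + Q ^ Suc n / q)
        * (alpha2 q 1 j * (1 - q ^ (4 * j + 2)) * (recip_qfact Q (Suc n) j * (1 / qpoch Q Q (Suc n + j + 1))))
      - alpha2 q 1 j * (1 - q ^ (4 * j + 2)) * (recip_qfact Q n j * (1 / qpoch Q Q (n + j + 1)))
      = alpha2 q 1 (Suc j) * h (Q ^ Suc n) (q ^ Suc j) * (recip_qfact Q (Suc n) (Suc j) * (1 / qpoch Q Q (n + Suc j + 1)))
      - alpha2 q 1 j * h (Q ^ Suc n) (q ^ j) * (recip_qfact Q (Suc n) j * (1 / qpoch Q Q (n + j + 1)))"
      unfolding e square_base_shift[of n j] q4 alpha2_Suc power_one_right power_Suc[of q j] h_def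
      by (rule telescoping_certificate2) (use q in auto)
  next
    show "alpha2 q 1 0 * (1 - q ^ (4 * 0 + 2)) * (recip_qfact Q 0 0 * (1 / qpoch Q Q (0 + 0 + 1)))
        = 1 / (qpoch Q Q 0 * qpoch (- q) q (2 * 0))"
      using one_minus_power_nonzero[OF Q_norm(1), of 1]
      by (simp add: alpha2_def recip_qfact_def qpoch_def Q numeral_2_eq_2)
    \<comment> \<open>As Q^(n+1) = q^(2n+2), this factors \<open>c n\<close> into the one new factor
      of (Q;Q) and the two new factors of (-q;q).\<close>
    have f: "(1 - (Q ^ Suc n)\<^sup>2) * (1 + Q ^ Suc n / q)
        = (1 - Q ^ Suc n) * ((1 + q ^ Suc (2 * n)) * (1 + q ^ Suc (Suc (2 * n))))" for n
    proof -
      have 1: "Q ^ Suc n = q ^ Suc (Suc (2 * n))" unfolding Q power_mult[symmetric] by simp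
      moreover have "Q ^ Suc n / q = q ^ Suc (2 * n)"
        unfolding 1 using q by simp
      ultimately show ?thesis by (simp add: power2_eq_square algebra_simps)
    qed
    show nz: "(1 - (Q ^ Suc n)\<^sup>2) * (1 + Q ^ Suc n / q) \<noteq> 0" for n
      unfolding f using one_plus_power_nonzero one_minus_power_nonzero[OF Q_norm(1), of "Suc n"]
      by (simp del: power_Suc)
    show "1 / (qpoch Q Q n * qpoch (- q) q (2 * n))
      = (1 - (Q ^ Suc n)\<^sup>2) * (1 + Q ^ Suc n / q) * (1 / (qpoch Q Q (Suc n) * qpoch (- q) q (2 * Suc n)))" for n
    proof -
      have "qpoch (- q) q (2 * Suc n) = qpoch (- q) q (2 * n) * ((1 + q ^ Suc (2 * n)) * (1 + q ^ Suc (Suc (2 * n))))"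
        by (simp add: qpoch_Suc)
      then show ?thesis
        using nz[of n] unfolding f by (simp add: qfact_Suc del: power_Suc)
    qed
  next
    show "alpha2 q 1 0 * h (Q ^ Suc n) (q ^ 0) * (recip_qfact Q (Suc n) 0 * (1 / qpoch Q Q (n + 0 + 1))) = 0" for n
      by (simp add: h_def)
  qed (simp_all add: recip_qfact_eq_0)
qed

lemma bailey_pair3:
  "(\<Sum>j\<le>n. alpha2 q 2 j * (1 - q ^ (2 * j + 1)) * (recip_qfact Q n j * (1 / qpoch Q Q (n + j + 1))))
       = 1 / (qpoch Q Q n * qpoch (- q) q (2 * n + 1))"
proof -
  define h where "h = (\<lambda>(Y::complex) X. - Y / X\<^sup>2 - Y\<^sup>2 / X + Y\<^sup>2 + Y * X)"
  show ?thesis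
  proof (rule bailey_pair_by_telescoping[where c = "\<lambda>n. (1 - (Q ^ Suc n)\<^sup>2) * (1 + q * Q ^ Suc n)"
        and G = "\<lambda>n j. alpha2 q 2 j * h (Q ^ Suc n) (q ^ j) * (recip_qfact Q (Suc n) j * (1 / qpoch Q Q (n + j + 1)))"])
    fix n j
    have q2: "q ^ (2 * j + 1) = q * (q ^ j)\<^sup>2"
      unfolding power_mult[symmetric] power_add[symmetric] power_Suc[symmetric] by (simp add: ac_simps)
    have e: "Suc n + j + 1 = n + j + 2" "n + Suc j + 1 = n + j + 2" by simp_all
    show "(1 - (Q ^ Suc n)\<^sup>2) * (1 + q * Q ^ Suc n)
        * (alpha2 q 2 j * (1 - q ^ (2 * j + 1)) * (recip_qfact Q (Suc n) j * (1 / qpoch Q Q (Suc n + j + 1))))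
      - alpha2 q 2 j * (1 - q ^ (2 * j + 1)) * (recip_qfact Q n j * (1 / qpoch Q Q (n + j + 1)))
      = alpha2 q 2 (Suc j) * h (Q ^ Suc n) (q ^ Suc j) * (recip_qfact Q (Suc n) (Suc j) * (1 / qpoch Q Q (n + Suc j + 1)))
      - alpha2 q 2 j * h (Q ^ Suc n) (q ^ j) * (recip_qfact Q (Suc n) j * (1 / qpoch Q Q (n + j + 1)))"
      unfolding e square_base_shift[of n j] q2 alpha2_Suc power_Suc[of q j] h_def
      by (rule telescoping_certificate3) (use q in auto)
  next
    \<comment> \<open>The initial value is (1 - q) / (1 - q^2) = 1 / (1 + q).\<close>
    show "alpha2 q 2 0 * (1 - q ^ (2 * 0 + 1)) * (recip_qfact Q 0 0 * (1 / qpoch Q Q (0 + 0 + 1)))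
        = 1 / (qpoch Q Q 0 * qpoch (- q) q (2 * 0 + 1))"
      using one_minus_power_nonzero[OF Q_norm(1), of 1] one_plus_power_nonzero[of 0]
      by (simp add: alpha2_def recip_qfact_def qpoch_def Q numeral_2_eq_2 divide_simps) algebra
    have f: "(1 - (Q ^ Suc n)\<^sup>2) * (1 + q * Q ^ Suc n)
        = (1 - Q ^ Suc n) * ((1 + q ^ Suc (2 * n + 1)) * (1 + q ^ Suc (Suc (2 * n + 1))))" for n
    proof -
      have "Q ^ Suc n = q ^ Suc (2 * n + 1)" unfolding Q power_mult[symmetric] by simp
      then show ?thesis by (simp add: power2_eq_square algebra_simps)
    qed
    show nz: "(1 - (Q ^ Suc n)\<^sup>2) * (1 + q * Q ^ Suc n) \<noteq> 0" for n
      unfolding f using one_plus_power_nonzero one_minus_power_nonzero[OF Q_norm(1), of "Suc n"]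
      by (simp del: power_Suc)
    show "1 / (qpoch Q Q n * qpoch (- q) q (2 * n + 1))
      = (1 - (Q ^ Suc n)\<^sup>2) * (1 + q * Q ^ Suc n) * (1 / (qpoch Q Q (Suc n) * qpoch (- q) q (2 * Suc n + 1)))" for n
    proof -
      have "qpoch (- q) q (2 * Suc n + 1)
          = qpoch (- q) q (2 * n + 1) * ((1 + q ^ Suc (2 * n + 1)) * (1 + q ^ Suc (Suc (2 * n + 1))))"
        by (simp add: qpoch_Suc)
      then show ?thesis
        using nz[of n] unfolding f by (simp add: qfact_Suc del: power_Suc)
    qed
  next
    show "alpha2 q 2 0 * h (Q ^ Suc n) (q ^ 0) * (recip_qfact Q (Suc n) 0 * (1 / qpoch Q Q (n + 0 + 1))) = 0" for n
      by (simp add: h_def)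
  qed (simp_all add: recip_qfact_eq_0)
qed

end

section \<open>False theta identities\<close>

lemma summable_norm_mult_power:
  fixes q :: complex
  assumes "norm q < 1" "Bseq c" "\<And>n. n \<le> e n"
  shows "summable (\<lambda>n. norm (c n * q ^ e n))"
proof -
  obtain K where K: "K > 0" "\<And>n. norm (c n) \<le> K"
    using assms(2) unfolding Bseq_def by blast
  show ?thesis
  proof (rule summable_comparison_test')
    show "summable (\<lambda>n. K * norm q ^ n)"
      using assms(1) by (intro summable_mult summable_geometric) simp
    have "norm (c n * q ^ e n) \<le> K * norm q ^ n" for n
      unfolding norm_mult norm_power
      using assms K by (intro mult_mono power_decreasing) (auto intro: less_imp_le)
    then show "norm (norm (c n * q ^ e n)) \<le> K * norm q ^ n" for n
      by simp
  qed
qed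

lemma summable_norm_add_mult:
  fixes f g :: "nat \<Rightarrow> complex"
  assumes "summable (\<lambda>n. norm (f n))" "summable (\<lambda>n. norm (g n))"
  shows "summable (\<lambda>n. norm (f n + c * g n))"
proof (rule summable_comparison_test')
  show "summable (\<lambda>n. norm (f n) + norm c * norm (g n))"
    by (intro summable_add summable_mult assms)
  show "norm (norm (f n + c * g n)) \<le> norm (f n) + norm c * norm (g n)" for n
    using norm_triangle_ineq[of "f n" "c * g n"] by (simp add: norm_mult)
qed

lemma sums_even_odd:
  fixes f :: "nat \<Rightarrow> 'a::real_normed_vector"
  assumes "(\<lambda>j. f (2 * j)) sums a" "(\<lambda>j. f (2 * j + 1)) sums b"
  shows "f sums (a + b)"
proof -
  have "(\<lambda>r. if even r then f r else 0) sums a"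
    by (subst sums_mono_reindex[of "\<lambda>j. 2 * j", symmetric])
      (use assms(1) in \<open>auto simp: strict_mono_def elim!: evenE\<close>)
  moreover have "(\<lambda>r. if odd r then f r else 0) sums b"
    by (subst sums_mono_reindex[of "\<lambda>j. 2 * j + 1", symmetric])
      (use assms(2) in \<open>auto simp: strict_mono_def elim!: oddE\<close>)
  ultimately have "(\<lambda>r. (if even r then f r else 0) + (if odd r then f r else 0)) sums (a + b)"
    by (rule sums_add)
  then show ?thesis by (rule sums_cong[THEN iffD1, rotated]) simp
qed

lemma even_odd_series:
  fixes f :: "nat \<Rightarrow> complex"
  assumes "summable (\<lambda>j. norm (f (2 * j)))" "summable (\<lambda>j. norm (f (2 * j + 1)))"
  shows "summable (\<lambda>r. norm (f r))" "suminf f = (\<Sum>j. f (2 * j)) + (\<Sum>j. f (2 * j + 1))"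
proof -
  show "summable (\<lambda>r. norm (f r))"
    using sums_even_odd[of "\<lambda>r. norm (f r)"] assms unfolding summable_def by blast
  show "suminf f = (\<Sum>j. f (2 * j)) + (\<Sum>j. f (2 * j + 1))"
    by (rule sums_unique[symmetric])
      (intro sums_even_odd summable_sums assms[THEN summable_norm_cancel])
qed

text \<open>Extending the range by zero terms to 2n + 1 gives every even index its odd partner and
  leaves j with the same bound n as in the Bailey pairs.\<close>

lemma sum_atMost_even_odd:
  fixes f :: "nat \<Rightarrow> complex"
  assumes "\<And>r. n < r \<Longrightarrow> f r = 0"
  shows "(\<Sum>r\<le>n. f r) = (\<Sum>j\<le>n. f (2 * j) + f (2 * j + 1))"
proof -
  have "(\<Sum>r<2 * k. f r) = (\<Sum>j<k. f (2 * j) + f (2 * j + 1))" for k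
    by (induction k) simp_all
  from this[of "Suc n"] have "(\<Sum>r<2 * Suc n. f r) = (\<Sum>j\<le>n. f (2 * j) + f (2 * j + 1))"
    unfolding lessThan_Suc_atMost .
  moreover have "(\<Sum>r\<le>n. f r) = (\<Sum>r<2 * Suc n. f r)"
    using assms by (intro sum.mono_neutral_left) auto
  ultimately show ?thesis by simp
qed

lemma Suc_double_choose_two:
  "Suc (2 * j) choose 2 = 2 * j\<^sup>2 + j" "Suc (2 * j + 1) choose 2 = 2 * j\<^sup>2 + 3 * j + 1"
  by (simp_all add: choose_two power2_eq_square algebra_simps)

lemma two_mult_choose_two: "2 * (r choose 2) + 2 * r = r * (r + 1)"
  by (induction r) (simp_all add: numeral_2_eq_2)

section \<open>Evaluation of the four sums\<close>

context
  fixes q :: complex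
  assumes q: "norm q < 1" "q \<noteq> 0"
begin

text \<open>The reciprocal products are bounded, so a geometric series dominates. The free sign
  exponent \<open>k n\<close> covers both (-1)^n and (-1)^(n+1).\<close>

lemma summable_norm_odd_qpochhammer:
  assumes "\<And>n. n \<le> e n"
  shows "summable (\<lambda>n. norm ((-1) ^ k n * q ^ e n / qpoch q (q\<^sup>2) (Suc n)))"
proof -
  have "norm (q\<^sup>2) < 1" using q by (simp add: norm_power power_less_one_iff)
  then obtain K where "K > 0" "\<And>n. norm (1 / qpoch q (q\<^sup>2) n) \<le> K"
    using qpoch_Bseq(2)[OF q(1)] unfolding Bseq_def by blast
  then have "Bseq (\<lambda>n. (-1) ^ k n / qpoch q (q\<^sup>2) (Suc n))"
    by (intro BseqI'[of _ K]) (simp add: norm_divide norm_power)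
  from summable_norm_mult_power[OF q(1) this assms] show ?thesis by simp
qed

lemma summable_norm_alternating_qpochhammer:
  assumes "\<And>n. n \<le> e n"
  shows "summable (\<lambda>n. norm ((-1) ^ n * q ^ e n / qpoch (- q) q (k n)))"
proof -
  obtain K where "K > 0" "\<And>n. norm (1 / qpoch (- q) q n) \<le> K"
    using qpoch_Bseq(2)[of "- q" q] q unfolding Bseq_def by auto
  then have "Bseq (\<lambda>n. (-1) ^ n / qpoch (- q) q (k n))"
    by (intro BseqI'[of _ K]) (simp add: norm_divide norm_power)
  from summable_norm_mult_power[OF q(1) this assms] show ?thesis by simp
qed

lemma summable_norm_signed_power:
  assumes "\<And>n. n \<le> e n"
  shows "summable (\<lambda>n. norm ((-1) ^ n * q ^ e n))"
  using summable_norm_mult_power[OF q(1) _ assms, of "\<lambda>n. (-1) ^ n"]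
  by (simp add: BseqI'[of _ 1] norm_power)

lemma summable_norm_power:
  assumes "\<And>n. n \<le> e n"
  shows "summable (\<lambda>n. norm (q ^ e n))"
  using summable_norm_mult_power[OF q(1) _ assms, of "\<lambda>n. 1"] by simp

text \<open>The pair is supported on even indices. The transform with l = 1 contributes 1 / (1 -
  q^(2j+1)) at index 2j, which cancels against 1 - q^(4j+2) and leaves 1 + q^(2j+1): one theta-like
  series for each summand.\<close>

lemma false_theta_identity1:
  "(\<Sum>n. (-1) ^ n * q ^ ((Suc n choose 2) + n) / qpoch q (q\<^sup>2) (Suc n))
     = (\<Sum>j. (-1) ^ j * q ^ (5 * j\<^sup>2 + 4 * j)) + q * (\<Sum>j. (-1) ^ j * q ^ (5 * j\<^sup>2 + 6 * j))"
proof -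
  define \<alpha> where "\<alpha> = (\<lambda>r. if even r then alpha1 q (r div 2) * (1 - q ^ (4 * (r div 2) + 2)) else 0)"
  define \<beta> where "\<beta> = (\<lambda>n. 1 / (qpoch q q n * qpoch q (q\<^sup>2) (Suc n)))"
  define f where "f = (\<lambda>r. bailey_weight q 1 r * (qpoch q q r / qpoch q q (r + 1)) * \<alpha> r)"
  have nz: "qpoch q q n \<noteq> 0" for n using q qpoch_nonzero by blast
  have \<beta>: "\<beta> n = (\<Sum>r\<le>n. \<alpha> r * (recip_qfact q n r / qpoch q q (n + r + Suc 1)))" for n
  proof -
    have "(\<Sum>r\<le>n. \<alpha> r * (recip_qfact q n r / qpoch q q (n + r + Suc 1)))
        = (\<Sum>j\<le>n. alpha1 q j * (1 - q ^ (4 * j + 2)) * (recip_qfact q n (2 * j) * (1 / qpoch q q (n + 2 * j + 2))))"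
      by (subst sum_atMost_even_odd) (auto simp: recip_qfact_eq_0 \<alpha>_def intro!: sum.cong)
    then show ?thesis unfolding bailey_pair1[OF q] \<beta>_def by simp
  qed
  have lhs: "bailey_weight q 1 n * qpoch q q n * \<beta> n
      = (-1) ^ n * q ^ ((Suc n choose 2) + n) / qpoch q (q\<^sup>2) (Suc n)" for n
    using nz by (simp add: bailey_weight_def \<beta>_def)
  have f_odd: "f (2 * j + 1) = 0" for j by (simp add: f_def \<alpha>_def)
  have f_even: "f (2 * j) = (-1) ^ j * q ^ (5 * j\<^sup>2 + 4 * j) + q * ((-1) ^ j * q ^ (5 * j\<^sup>2 + 6 * j))" for j
  proof -
    have "1 - q ^ Suc (2 * j) \<noteq> 0" using q by (intro one_minus_power_nonzero) auto
    moreover have "1 - q ^ (4 * j + 2) = (1 - q ^ Suc (2 * j)) * (1 + q ^ Suc (2 * j))"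
      by (simp add: algebra_simps flip: power_add)
    ultimately have "qpoch q q (2 * j) / qpoch q q (2 * j + 1) * (1 - q ^ (4 * j + 2)) = 1 + q ^ Suc (2 * j)"
      using nz[of "2 * j"] by (simp add: qfact_Suc del: power_Suc)
    note this[symmetric]
    moreover have "f (2 * j) = bailey_weight q 1 (2 * j) * alpha1 q j
        * (qpoch q q (2 * j) / qpoch q q (2 * j + 1) * (1 - q ^ (4 * j + 2)))"
      by (simp add: f_def \<alpha>_def)
    ultimately have "f (2 * j) = bailey_weight q 1 (2 * j) * alpha1 q j * (1 + q ^ Suc (2 * j))"
      by (simp only:)
    also have "bailey_weight q 1 (2 * j) * alpha1 q j = (-1) ^ j * q ^ (5 * j\<^sup>2 + 4 * j)"
      unfolding bailey_weight_def alpha1_def Suc_double_choose_two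
      by (simp add: algebra_simps flip: power_add)
    finally show ?thesis by (simp add: algebra_simps flip: power_add)
  qed
  have A: "summable (\<lambda>j. norm ((-1) ^ j * q ^ (5 * j\<^sup>2 + 4 * j)))"
    and B: "summable (\<lambda>j. norm ((-1) ^ j * q ^ (5 * j\<^sup>2 + 6 * j)))"
    by (intro summable_norm_signed_power; simp)+
  have "summable (\<lambda>j. norm (f (2 * j)))"
    unfolding f_even by (rule summable_norm_add_mult[OF A B])
  then have f: "summable (\<lambda>r. norm (f r))" "suminf f = (\<Sum>j. f (2 * j))"
    using even_odd_series[of f] unfolding f_odd by simp_all
  have "(\<Sum>n. bailey_weight q 1 n * qpoch q q n * \<beta> n) = suminf f"
    unfolding f_def
  proof (rule bailey_transform[OF q(1) \<beta>])
    show "summable (\<lambda>n. norm (bailey_weight q 1 n * qpoch q q n * \<beta> n))"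
      unfolding lhs by (rule summable_norm_odd_qpochhammer) simp
  qed (use f(1) in \<open>simp add: f_def\<close>)
  also have "\<dots> = (\<Sum>j. (-1) ^ j * q ^ (5 * j\<^sup>2 + 4 * j)) + q * (\<Sum>j. (-1) ^ j * q ^ (5 * j\<^sup>2 + 6 * j))"
    unfolding f(2) f_even
    using summable_norm_cancel[OF A] summable_norm_cancel[OF B]
    by (subst suminf_add[symmetric]) (auto simp: suminf_mult intro: summable_mult)
  finally show ?thesis unfolding lhs .
qed

text \<open>The same \<beta> is expanded relative to a = q, so l = 0 and the quotient of
  q-factorials is 1. The two series now come from the even and the odd indices.\<close>

lemma false_theta_identity2:
  "(\<Sum>n. (-1) ^ n * q ^ (Suc n choose 2) / qpoch q (q\<^sup>2) (Suc n))
     = (\<Sum>j. (-1) ^ j * q ^ (5 * j\<^sup>2 + 2 * j)) + q ^ 3 * (\<Sum>j. (-1) ^ j * q ^ (5 * j\<^sup>2 + 8 * j))"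
proof -
  define \<alpha> where "\<alpha> = (\<lambda>r. if even r then alpha1 q (r div 2) else - alpha1 q (r div 2) * q ^ (4 * (r div 2) + 2))"
  define \<beta> where "\<beta> = (\<lambda>n. 1 / (qpoch q q n * qpoch q (q\<^sup>2) (Suc n)))"
  define f where "f = (\<lambda>r. bailey_weight q 0 r * (qpoch q q r / qpoch q q (r + 0)) * \<alpha> r)"
  have nz: "qpoch q q n \<noteq> 0" for n using q qpoch_nonzero by blast
  text \<open>Consecutive even and odd terms collapse to the summand of the pair relative to \<open>a = q\<^sup>2\<close>.\<close>
  have pair: "\<alpha> (2 * j) * (recip_qfact q n (2 * j) / qpoch q q (n + 2 * j + Suc 0))
      + \<alpha> (2 * j + 1) * (recip_qfact q n (2 * j + 1) / qpoch q q (n + (2 * j + 1) + Suc 0))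
      = alpha1 q j * (1 - q ^ (4 * j + 2)) * (recip_qfact q n (2 * j) * (1 / qpoch q q (n + 2 * j + 2)))" for n j
  proof -
    define Z where "Z = q ^ (2 * j)"
    have "Z \<noteq> 0" using q by (simp add: Z_def)
    have 1: "recip_qfact q n (2 * j + 1) = (1 - q ^ n / Z) * recip_qfact q n (2 * j)"
      unfolding Z_def using recip_qfact_Suc_right'[OF q] by simp
    have 2: "1 / qpoch q q (n + 2 * j + Suc 0) = (1 - q\<^sup>2 * q ^ n * Z) * (1 / qpoch q q (n + 2 * j + 2))"
      by (subst inverse_qfact_Suc[OF q(1)]) (simp add: Z_def power_add power2_eq_square)
    have 3: "q ^ (4 * j + 2) = q\<^sup>2 * Z\<^sup>2"
      unfolding Z_def power_mult[symmetric] power_add[symmetric] by (simp add: ac_simps)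
    have 4: "n + (2 * j + 1) + Suc 0 = n + 2 * j + 2" by simp
    have \<alpha>: "\<alpha> (2 * j) = alpha1 q j" "\<alpha> (2 * j + 1) = - alpha1 q j * (q\<^sup>2 * Z\<^sup>2)"
      by (simp_all add: \<alpha>_def flip: 3)
    \<comment> \<open>The mixed terms cancel in (1 - q^2 q^n Z) - q^2 Z^2 (1 - q^n / Z) = 1 - q^2
      Z^2.\<close>
    have "alpha1 q j * (R * ((1 - q\<^sup>2 * q ^ n * Z) * P)) + - alpha1 q j * (q\<^sup>2 * Z\<^sup>2) * ((1 - q ^ n / Z) * R * P)
        = alpha1 q j * (1 - q\<^sup>2 * Z\<^sup>2) * (R * P)" for R P
      using \<open>Z \<noteq> 0\<close> by (simp add: field_simps power2_eq_square)
    then show ?thesis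
      unfolding \<alpha> 1 3 4 divide_inverse[of "recip_qfact _ _ _"] divide_inverse[of "_ * recip_qfact _ _ _"]
        inverse_eq_divide 2 by blast
  qed
  have \<beta>: "\<beta> n = (\<Sum>r\<le>n. \<alpha> r * (recip_qfact q n r / qpoch q q (n + r + Suc 0)))" for n
    by (subst sum_atMost_even_odd) (simp add: recip_qfact_eq_0, simp only: pair bailey_pair1[OF q] \<beta>_def)
  have lhs: "bailey_weight q 0 n * qpoch q q n * \<beta> n
      = (-1) ^ n * q ^ (Suc n choose 2) / qpoch q (q\<^sup>2) (Suc n)" for n
    using nz by (simp add: bailey_weight_def \<beta>_def)
  have f_even: "f (2 * j) = (-1) ^ j * q ^ (5 * j\<^sup>2 + 2 * j)" for j
    using nz unfolding f_def \<alpha>_def bailey_weight_def alpha1_def Suc_double_choose_two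
    by (simp add: algebra_simps flip: power_add)
  \<comment> \<open>The weight at an odd index is negative and cancels the minus sign in
    \<alpha>.\<close>
  have f_odd: "f (2 * j + 1) = q ^ 3 * ((-1) ^ j * q ^ (5 * j\<^sup>2 + 8 * j))" for j
  proof -
    have "q ^ (2 * j\<^sup>2 + 3 * j + 1) * q ^ (3 * j\<^sup>2 + j) * q ^ (4 * j + 2) = q ^ 3 * q ^ (5 * j\<^sup>2 + 8 * j)"
      unfolding power_add[symmetric] by (rule arg_cong[where f = "power q"]) simp
    then show ?thesis
      using nz unfolding f_def \<alpha>_def bailey_weight_def alpha1_def Suc_double_choose_two
      by (simp add: mult_ac)
  qed
  have A: "summable (\<lambda>j. norm ((-1) ^ j * q ^ (5 * j\<^sup>2 + 2 * j)))"
    and B: "summable (\<lambda>j. norm ((-1) ^ j * q ^ (5 * j\<^sup>2 + 8 * j)))"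
    by (intro summable_norm_signed_power; simp)+
  have "summable (\<lambda>j. norm (f (2 * j)))" "summable (\<lambda>j. norm (f (2 * j + 1)))"
    unfolding f_even f_odd norm_mult[of "q ^ 3"] by (intro A summable_mult B)+
  note f = even_odd_series[OF this]
  have "(\<Sum>n. bailey_weight q 0 n * qpoch q q n * \<beta> n) = suminf f"
    unfolding f_def
  proof (rule bailey_transform[OF q(1) \<beta>])
    show "summable (\<lambda>n. norm (bailey_weight q 0 n * qpoch q q n * \<beta> n))"
      unfolding lhs by (rule summable_norm_odd_qpochhammer) (simp add: numeral_2_eq_2)
  qed (use f(1) in \<open>simp add: f_def\<close>)
  then show ?thesis
    unfolding lhs f(2) f_even f_odd using summable_norm_cancel[OF B] by (simp add: suminf_mult)
qed

text \<open>In base q^2 with l = 0 the weight is (-1)^n q^(n(n+1)); its sign cancels that of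
  \<open>alpha2\<close>, so the resulting series have no signs. The factor
  \<open>1 - q ^ (i * j + d)\<close> yields the difference of two series.\<close>

lemma square_base_identity:
  assumes pair: "\<And>n. (\<Sum>j\<le>n. alpha2 q k j * (1 - q ^ (i * j + d)) * (recip_qfact (q\<^sup>2) n j * (1 / qpoch (q\<^sup>2) (q\<^sup>2) (n + j + 1))))
       = 1 / (qpoch (q\<^sup>2) (q\<^sup>2) n * qpoch (- q) q (h n))"
  shows "(\<Sum>n. (-1) ^ n * q ^ (n * (n + 1)) / qpoch (- q) q (h n))
     = (\<Sum>j. q ^ (5 * (j choose 2) + (k + 2) * j)) - q ^ d * (\<Sum>j. q ^ (5 * (j choose 2) + (k + i + 2) * j))"
proof -
  let ?Q = "q\<^sup>2"
  define \<alpha> where "\<alpha> = (\<lambda>j. alpha2 q k j * (1 - q ^ (i * j + d)))"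
  define \<beta> where "\<beta> = (\<lambda>n. 1 / (qpoch ?Q ?Q n * qpoch (- q) q (h n)))"
  have Q: "norm ?Q < 1" using Q_norm[OF q refl] by simp
  have nz: "qpoch ?Q ?Q n \<noteq> 0" for n using Q qpoch_nonzero by blast
  have \<beta>: "\<beta> n = (\<Sum>j\<le>n. \<alpha> j * (recip_qfact ?Q n j / qpoch ?Q ?Q (n + j + Suc 0)))" for n
    using pair[of n] by (simp add: \<alpha>_def \<beta>_def)
  have W: "bailey_weight ?Q 0 n = (-1) ^ n * q ^ (n * (n + 1))" for n
    unfolding bailey_weight_def two_mult_choose_two[symmetric] power_mult[symmetric]
    by (simp add: numeral_2_eq_2 algebra_simps)
  have lhs: "bailey_weight ?Q 0 n * qpoch ?Q ?Q n * \<beta> n = (-1) ^ n * q ^ (n * (n + 1)) / qpoch (- q) q (h n)" for n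
    using nz by (simp add: W \<beta>_def)
  have rhs: "bailey_weight ?Q 0 j * (qpoch ?Q ?Q j / qpoch ?Q ?Q (j + 0)) * \<alpha> j
      = q ^ (5 * (j choose 2) + (k + 2) * j) - q ^ d * q ^ (5 * (j choose 2) + (k + i + 2) * j)" for j
    using nz unfolding W \<alpha>_def alpha2_def two_mult_choose_two[symmetric]
    by (simp add: algebra_simps flip: power_add)
  have A: "summable (\<lambda>j. norm (q ^ (5 * (j choose 2) + (k + 2) * j)))"
    and B: "summable (\<lambda>j. norm (q ^ (5 * (j choose 2) + (k + i + 2) * j)))"
    by (intro summable_norm_power; simp)+
  have "(\<Sum>n. bailey_weight ?Q 0 n * qpoch ?Q ?Q n * \<beta> n)
      = (\<Sum>j. bailey_weight ?Q 0 j * (qpoch ?Q ?Q j / qpoch ?Q ?Q (j + 0)) * \<alpha> j)"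
  proof (rule bailey_transform[OF Q \<beta>])
    show "summable (\<lambda>n. norm (bailey_weight ?Q 0 n * qpoch ?Q ?Q n * \<beta> n))"
      unfolding lhs by (rule summable_norm_alternating_qpochhammer) simp
    show "summable (\<lambda>j. norm (bailey_weight ?Q 0 j * (qpoch ?Q ?Q j / qpoch ?Q ?Q (j + 0)) * \<alpha> j))"
      unfolding rhs using summable_norm_add_mult[OF A B, of "- (q ^ d)"] by simp
  qed
  then show ?thesis
    unfolding lhs rhs using summable_norm_cancel[OF A] summable_norm_cancel[OF B]
    by (simp add: suminf_diff[symmetric] suminf_mult summable_mult)
qed

end

section \<open>Assembly of the four identities\<close>

theorem theorem3p3:
  fixes q :: complex
  assumes "0 < norm q" and "norm q < 1"
  shows
   "(summable (\<lambda>n. (-1) ^ (n+1) * q ^ ((n+2) choose 2) / qpoch q (q^2) (n+1)) \<and>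
     summable (\<lambda>n. (-1) ^ n * q powi (- int n + 5 * int n * (int n + 1))) \<and>
     summable (\<lambda>n. (-1) ^ n * q powi (int n + 5 * int n * (int n + 1))) \<and>
     (\<Sum>n. (-1) ^ (n+1) * q ^ ((n+2) choose 2) / qpoch q (q^2) (n+1))
       = - q * (\<Sum>n. (-1) ^ n * q powi (- int n + 5 * int n * (int n + 1)))
         - q^2 * (\<Sum>n. (-1) ^ n * q powi (int n + 5 * int n * (int n + 1)))) \<and>
    (summable (\<lambda>n. (-1) ^ (n+1) * q ^ ((n+1) choose 2) / qpoch q (q^2) (n+1)) \<and>
     summable (\<lambda>n. (-1) ^ n * q powi (- 3 * int n + 5 * int n * (int n + 1))) \<and>
     summable (\<lambda>n. (-1) ^ n * q powi (3 * int n + 5 * int n * (int n + 1))) \<and>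
     (\<Sum>n. (-1) ^ (n+1) * q ^ ((n+1) choose 2) / qpoch q (q^2) (n+1))
       = - (\<Sum>n. (-1) ^ n * q powi (- 3 * int n + 5 * int n * (int n + 1)))
         - q^3 * (\<Sum>n. (-1) ^ n * q powi (3 * int n + 5 * int n * (int n + 1)))) \<and>
    (summable (\<lambda>n. (-1) ^ n * q ^ (n * (n+1)) / qpoch (- q) q (2*n)) \<and>
     summable (\<lambda>n. q powi (- 2 * int n + (5 * int n * (int n + 1)) div 2)) \<and>
     summable (\<lambda>n. q powi (2 * int n + (5 * int n * (int n + 1)) div 2)) \<and>
     (\<Sum>n. (-1) ^ n * q ^ (n * (n+1)) / qpoch (- q) q (2*n))
       = (\<Sum>n. q powi (- 2 * int n + (5 * int n * (int n + 1)) div 2))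
         - q^2 * (\<Sum>n. q powi (2 * int n + (5 * int n * (int n + 1)) div 2))) \<and>
    (summable (\<lambda>n. (-1) ^ n * q ^ (n * (n+1)) / qpoch (- q) q (2*n+1)) \<and>
     summable (\<lambda>n. q powi (- int n + (5 * int n * (int n + 1)) div 2)) \<and>
     summable (\<lambda>n. q powi (int n + (5 * int n * (int n + 1)) div 2)) \<and>
     (\<Sum>n. (-1) ^ n * q ^ (n * (n+1)) / qpoch (- q) q (2*n+1))
       = (\<Sum>n. q powi (- int n + (5 * int n * (int n + 1)) div 2))
         - q * (\<Sum>n. q powi (int n + (5 * int n * (int n + 1)) div 2)))"
proof -
  have q: "norm q < 1" "q \<noteq> 0" using assms by auto
  \<comment> \<open>Every integer exponent is in fact a natural number, so \<open>powi\<close>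
    reduces to the ordinary power.\<close>
  have e: "- int n + 5 * int n * (int n + 1) = int (5 * n\<^sup>2 + 4 * n)"
    "int n + 5 * int n * (int n + 1) = int (5 * n\<^sup>2 + 6 * n)"
    "- 3 * int n + 5 * int n * (int n + 1) = int (5 * n\<^sup>2 + 2 * n)"
    "3 * int n + 5 * int n * (int n + 1) = int (5 * n\<^sup>2 + 8 * n)" for n
    by (simp_all add: power2_eq_square algebra_simps)
  \<comment> \<open>The integer division is exact because n(n+1) is even.\<close>
  have half: "(5 * int n * (int n + 1)) div 2 = int (5 * (n choose 2) + 5 * n)" for n
  proof -
    have "int n * (int n + 1) = int (2 * (n choose 2) + 2 * n)"
      unfolding two_mult_choose_two by (simp add: algebra_simps)
    then have "5 * int n * (int n + 1) = 2 * int (5 * (n choose 2) + 5 * n)"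
      by simp
    then show ?thesis by simp
  qed
  have e': "- 2 * int n + (5 * int n * (int n + 1)) div 2 = int (5 * (n choose 2) + 3 * n)"
    "2 * int n + (5 * int n * (int n + 1)) div 2 = int (5 * (n choose 2) + 7 * n)"
    "- int n + (5 * int n * (int n + 1)) div 2 = int (5 * (n choose 2) + 4 * n)"
    "int n + (5 * int n * (int n + 1)) div 2 = int (5 * (n choose 2) + 6 * n)" for n
    unfolding half by simp_all
  note S = summable_norm_cancel[OF summable_norm_odd_qpochhammer[OF q]]
    summable_norm_cancel[OF summable_norm_alternating_qpochhammer[OF q]]
    summable_norm_cancel[OF summable_norm_signed_power[OF q]]
    summable_norm_cancel[OF summable_norm_power[OF q]]
  have c2: "n \<le> Suc n choose 2" for n by (simp add: numeral_2_eq_2)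
  have c2': "n \<le> Suc (Suc n) choose 2" for n by (simp add: numeral_2_eq_2)
  have s: "summable (\<lambda>n. (-1) ^ Suc n * q ^ (Suc (Suc n) choose 2) / qpoch q (q\<^sup>2) (Suc n))"
    "summable (\<lambda>n. (-1) ^ Suc n * q ^ (Suc n choose 2) / qpoch q (q\<^sup>2) (Suc n))"
    by (rule S, rule c2') (rule S, rule c2)
  \<comment> \<open>The prefactor -q comes from the sign and from C(n+2,2) = C(n+1,2) + n +
    1.\<close>
  have t1: "(-1) ^ Suc n * q ^ (Suc (Suc n) choose 2) / qpoch q (q\<^sup>2) (Suc n)
      = - q * ((-1) ^ n * q ^ ((Suc n choose 2) + n) / qpoch q (q\<^sup>2) (Suc n))" for n
    by (simp add: Suc_Suc_choose_two del: binomial_Suc_Suc)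
  have t2: "(-1) ^ Suc n * q ^ (Suc n choose 2) / qpoch q (q\<^sup>2) (Suc n)
      = - ((-1) ^ n * q ^ (Suc n choose 2) / qpoch q (q\<^sup>2) (Suc n))" for n
    by simp
  have i1: "(\<Sum>n. (-1) ^ Suc n * q ^ (Suc (Suc n) choose 2) / qpoch q (q\<^sup>2) (Suc n))
      = - q * (\<Sum>n. (-1) ^ n * q ^ (5 * n\<^sup>2 + 4 * n)) - q\<^sup>2 * (\<Sum>n. (-1) ^ n * q ^ (5 * n\<^sup>2 + 6 * n))"
  proof -
    have "summable (\<lambda>n. (-1) ^ n * q ^ ((Suc n choose 2) + n) / qpoch q (q\<^sup>2) (Suc n))"
      by (rule S) simp
    from suminf_mult[OF this, of "- q"] show ?thesis
      unfolding t1 false_theta_identity1[OF q] by (simp add: algebra_simps power2_eq_square)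
  qed
  have i2: "(\<Sum>n. (-1) ^ Suc n * q ^ (Suc n choose 2) / qpoch q (q\<^sup>2) (Suc n))
      = - (\<Sum>n. (-1) ^ n * q ^ (5 * n\<^sup>2 + 2 * n)) - q ^ 3 * (\<Sum>n. (-1) ^ n * q ^ (5 * n\<^sup>2 + 8 * n))"
    unfolding t2 by (subst suminf_minus) (use c2 in \<open>auto intro: S simp: false_theta_identity2[OF q]\<close>)
  \<comment> \<open>Here k = 1, i = 4, d = 2, which gives the linear exponents 3n and 7n; the next
    identity has k = 2, i = 2, d = 1.\<close>
  have i3: "(\<Sum>n. (-1) ^ n * q ^ (n * Suc n) / qpoch (- q) q (2 * n))
      = (\<Sum>n. q ^ (5 * (n choose 2) + 3 * n)) - q\<^sup>2 * (\<Sum>n. q ^ (5 * (n choose 2) + 7 * n))"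
    using square_base_identity[OF q bailey_pair2[OF q refl]] by (simp add: ac_simps)
  have i4: "(\<Sum>n. (-1) ^ n * q ^ (n * Suc n) / qpoch (- q) q (Suc (2 * n)))
      = (\<Sum>n. q ^ (5 * (n choose 2) + 4 * n)) - q * (\<Sum>n. q ^ (5 * (n choose 2) + 6 * n))"
    using square_base_identity[OF q, of 2 2 1 "\<lambda>n. 2 * n + 1"] bailey_pair3[OF q refl] by simp
  show ?thesis
    unfolding e e' power_int_of_nat Suc_eq_plus1[symmetric] add_2_eq_Suc'
    by (intro conjI) (use i1 i2 i3 i4 s in \<open>simp_all add: S\<close>)
qed

end
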